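(* Let $(R,\preceq)$ be a quasi-ordered ring. Then either $(R,\preceq)$ is an ordered ring, or else there is a valuation $v$ on $R$ such that for all $x,y\in R$: $x\preceq y$ if and only if $v(y)\le v(x)$. Moreover, the support of the quasi-order $\preceq$ coincides with the support of this order, respectively with the support of this valuation.
   Context: All rings are commutative with $1$. For a reflexive and transitive binary relation $\preceq$ on a set, write $a\sim b$ for ($a\preceq b$ and $b\preceq a$), and $a\prec b$ for ($a\preceq b$ and not $b\preceq a$). Quasi-ordered ring: a pair $(R,\preceq)$ where $R$ is a commutative ring with $1$ and $\preceq$ is a binary, reflexive, transitive and total relation on $R$ such that for all $x,y,z\in R$: (QR1) $0\prec 1$; (QR2) $xy\preceq 0\Rightarrow x\preceq 0$ or $y\preceq 0$; (QR3) $x\preceq y$ and $0\preceq z\Rightarrow xz\preceq yz$; (QR4) $x\preceq y$ and $z\nsim y\Rightarrow x+z\preceq y+z$; (QR5) if $0\prec z$, then $xz\preceq yz\Rightarrow x\preceq y$. Its support is $E_0=\{x\in R: x\sim 0\}$. Ordered ring: a pair $(R,\le)$ where $\le$ is a binary, reflexive, transitive and total relation on $R$ (not necessarily antisymmetric) such that for all $x,y,z\in R$: (O1) $0<1$ (i.e. $0\le 1$ and not $1\le 0$); (O2) $xy\le 0\Rightarrow x\le 0$ or $y\le 0$; (O3) $x\le y$ and $0\le z\Rightarrow xz\le yz$; (O4) $x\le y\Rightarrow x+z\le y+z$. Its support is $\{x\in R: x\le 0 \text{ and } 0\le x\}$. Valuation: a map $v:R\to\Gamma\cup\{\infty\}$,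 where $\Gamma$ is a (totally) ordered abelian group, $\gamma<\infty$ and $\infty=\infty+\infty=\gamma+\infty=\infty+\gamma$ for all $\gamma\in\Gamma$, such that for all $x,y\in R$: $v(0)=\infty$, $v(1)=0$, $v(xy)=v(x)+v(y)$, $v(x+y)\ge\min\{v(x),v(y)\}$. It is always assumed that $\Gamma$ is the group generated by $\{v(x): v(x)\ne\infty\}$. The support of $v$ is $v^{-1}(\infty)$. *)

theory Defs
  imports "HOL-Algebra.Ring" "HOL-Algebra.Generated_Groups"
begin

section \<open>Quasi-ordered and ordered rings\<close>

text \<open>
  A relation on a ring is a binary predicate; only its restriction to the carrier matters.
  Antisymmetry is not required. Note that \<open>totalp_on\<close> speaks about
  distinct elements only, the remaining instances being covered by reflexivity.
\<close>

locale total_preordered_cring = cring R for R (structure) +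
  fixes leR :: "'a \<Rightarrow> 'a \<Rightarrow> bool" (infix \<open>\<preceq>\<close> 50)
  assumes le_reflp: "reflp_on (carrier R) (\<preceq>)"
    and le_transp: "transp_on (carrier R) (\<preceq>)"
    and le_totalp: "totalp_on (carrier R) (\<preceq>)"
begin

abbreviation prec :: "'a \<Rightarrow> 'a \<Rightarrow> bool" (infix \<open>\<prec>\<close> 50)
  where "x \<prec> y \<equiv> x \<preceq> y \<and> \<not> y \<preceq> x"

abbreviation equivalent :: "'a \<Rightarrow> 'a \<Rightarrow> bool" (infix \<open>\<sim>\<close> 50)
  where "x \<sim> y \<equiv> x \<preceq> y \<and> y \<preceq> x"

end

locale quasi_ordered_cring = total_preordered_cring +
  assumes QR1: "\<zero> \<prec> \<one>"
    and QR2: "\<lbrakk>x \<in> carrier R; y \<in> carrier R; x \<otimes> y \<preceq> \<zero>\<rbrakk> \<Longrightarrow> x \<preceq> \<zero> \<or> y \<preceq> \<zero>"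
    and QR3: "\<lbrakk>x \<in> carrier R; y \<in> carrier R; z \<in> carrier R; x \<preceq> y; \<zero> \<preceq> z\<rbrakk>
      \<Longrightarrow> x \<otimes> z \<preceq> y \<otimes> z"
    and QR4: "\<lbrakk>x \<in> carrier R; y \<in> carrier R; z \<in> carrier R; x \<preceq> y; \<not> z \<sim> y\<rbrakk>
      \<Longrightarrow> x \<oplus> z \<preceq> y \<oplus> z"
    and QR5: "\<lbrakk>x \<in> carrier R; y \<in> carrier R; z \<in> carrier R; \<zero> \<prec> z; x \<otimes> z \<preceq> y \<otimes> z\<rbrakk>
      \<Longrightarrow> x \<preceq> y"

locale ordered_cring = total_preordered_cring +
  assumes O1: "\<zero> \<prec> \<one>"
    and O2: "\<lbrakk>x \<in> carrier R; y \<in> carrier R; x \<otimes> y \<preceq> \<zero>\<rbrakk> \<Longrightarrow> x \<preceq> \<zero> \<or> y \<preceq> \<zero>"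
    and O3: "\<lbrakk>x \<in> carrier R; y \<in> carrier R; z \<in> carrier R; x \<preceq> y; \<zero> \<preceq> z\<rbrakk>
      \<Longrightarrow> x \<otimes> z \<preceq> y \<otimes> z"
    and O4: "\<lbrakk>x \<in> carrier R; y \<in> carrier R; z \<in> carrier R; x \<preceq> y\<rbrakk> \<Longrightarrow> x \<oplus> z \<preceq> y \<oplus> z"

text \<open>The two supports are given by the same formula, but belong to different structures.\<close>

definition quasi_order_support :: "('a, 'm) ring_scheme \<Rightarrow> ('a \<Rightarrow> 'a \<Rightarrow> bool) \<Rightarrow> 'a set"
  where "quasi_order_support R leR = {x \<in> carrier R. leR x \<zero>\<^bsub>R\<^esub> \<and> leR \<zero>\<^bsub>R\<^esub> x}"

definition order_support :: "('a, 'm) ring_scheme \<Rightarrow> ('a \<Rightarrow> 'a \<Rightarrow> bool) \<Rightarrow> 'a set"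
  where "order_support R leR = {x \<in> carrier R. leR x \<zero>\<^bsub>R\<^esub> \<and> leR \<zero>\<^bsub>R\<^esub> x}"

section \<open>Valuations\<close>

text \<open>
  The value group is written multiplicatively, as are all groups in HOL-Algebra:
  its operation \<open>\<otimes>\<close> is the addition of values and its \<open>\<one>\<close> is the value \<open>0\<close>.
\<close>

locale totally_ordered_comm_group = comm_group G for G (structure) +
  fixes leG :: "'g \<Rightarrow> 'g \<Rightarrow> bool" (infix \<open>\<sqsubseteq>\<close> 50)
  assumes group_le_reflp: "reflp_on (carrier G) (\<sqsubseteq>)"
    and group_le_transp: "transp_on (carrier G) (\<sqsubseteq>)"
    and group_le_antisymp: "antisymp_on (carrier G) (\<sqsubseteq>)"
    and group_le_totalp: "totalp_on (carrier G) (\<sqsubseteq>)"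
    and group_le_mult: "\<lbrakk>a \<in> carrier G; b \<in> carrier G; c \<in> carrier G; a \<sqsubseteq> b\<rbrakk>
      \<Longrightarrow> a \<otimes> c \<sqsubseteq> b \<otimes> c"

text \<open>\<open>None\<close> encodes the value \<open>\<infinity>\<close>.\<close>

fun value_add :: "('g, 'm) monoid_scheme \<Rightarrow> 'g option \<Rightarrow> 'g option \<Rightarrow> 'g option"
  where
    "value_add G (Some a) (Some b) = Some (a \<otimes>\<^bsub>G\<^esub> b)"
  | "value_add G None _ = None"
  | "value_add G _ None = None"

fun value_le :: "('g \<Rightarrow> 'g \<Rightarrow> bool) \<Rightarrow> 'g option \<Rightarrow> 'g option \<Rightarrow> bool"
  where
    "value_le leG _ None \<longleftrightarrow> True"
  | "value_le leG None (Some b) \<longleftrightarrow> False"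
  | "value_le leG (Some a) (Some b) \<longleftrightarrow> leG a b"

definition value_min :: "('g \<Rightarrow> 'g \<Rightarrow> bool) \<Rightarrow> 'g option \<Rightarrow> 'g option \<Rightarrow> 'g option"
  where "value_min leG a b = (if value_le leG a b then a else b)"

locale ring_valuation = cring R + value_group: totally_ordered_comm_group G leG
  for R :: "('a, 'm) ring_scheme" (structure)
    and G :: "('g, 'n) monoid_scheme"
    and leG :: "'g \<Rightarrow> 'g \<Rightarrow> bool" +
  fixes v :: "'a \<Rightarrow> 'g option"
  assumes v_closed: "x \<in> carrier R \<Longrightarrow> v x \<in> insert None (Some ` carrier G)"
    and v_zero: "v \<zero> = None"
    and v_one: "v \<one> = Some \<one>\<^bsub>G\<^esub>"
    and v_mult: "\<lbrakk>x \<in> carrier R; y \<in> carrier R\<rbrakk> \<Longrightarrow> v (x \<otimes> y) = value_add G (v x) (v y)"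
    and v_add: "\<lbrakk>x \<in> carrier R; y \<in> carrier R\<rbrakk>
      \<Longrightarrow> value_le leG (value_min leG (v x) (v y)) (v (x \<oplus> y))"
    and v_generates: "generate G {g. \<exists>x \<in> carrier R. v x = Some g} = carrier G"

definition valuation_support :: "('a, 'm) ring_scheme \<Rightarrow> ('a \<Rightarrow> 'g option) \<Rightarrow> 'a set"
  where "valuation_support R v = {x \<in> carrier R. v x = None}"

text \<open>\<open>x \<preceq> y\<close> if and only if \<open>v y \<le> v x\<close>.\<close>

definition induced_by_valuation ::
    "('a, 'm) ring_scheme \<Rightarrow> ('a \<Rightarrow> 'a \<Rightarrow> bool) \<Rightarrow> ('g \<Rightarrow> 'g \<Rightarrow> bool) \<Rightarrow> ('a \<Rightarrow> 'g option) \<Rightarrow> bool"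
  where "induced_by_valuation R leR leG v \<longleftrightarrow>
    (\<forall>x \<in> carrier R. \<forall>y \<in> carrier R. leR x y \<longleftrightarrow> value_le leG (v y) (v x))"

text \<open>
  HOL cannot quantify existentially over types, so an existence statement about valuations has to
  name a type in which the value group lives. The type \<^typ>\<open>('a \<times> 'a) set\<close> is large enough for every
  valuation on a ring with elements in \<^typ>\<open>'a\<close>: the value group is generated by the finite values,
  which are closed under addition, so each of its elements \<open>g\<close> is a difference of two of
  them, and \<open>g\<close> is determined by the set of all \<open>(x, y)\<close> with \<open>v x\<close>, \<open>v y\<close> finite
  and \<open>g = v x - v y\<close>.
\<close>

end

theory Submission
  imports Defs
begin

text \<open>
  The sign of \<open>-1\<close> decides. If \<open>-1 \<preceq> 0\<close>, then negation reverses the order, which reduces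
  \<open>x + z \<preceq> y + z\<close>, in the case \<open>z \<sim> y\<close> excluded by (QR4), to positive \<open>y\<close>. There it follows by adding
  first \<open>z + z\<close> and then \<open>-z\<close>, neither of which is equivalent to the element that (QR4) compares it
  with. If \<open>0 \<preceq> -1\<close>, then \<open>-1 \<sim> 1\<close>, hence \<open>x \<sim> -x\<close> for all \<open>x\<close>, every element is nonnegative, and
  (QR4) becomes the ultrametric inequality. The values are then the fractions of elements outside
  the support, modulo equivalence.
\<close>

section \<open>Signs and the support\<close>

context total_preordered_cring
begin

lemma le_refl: "x \<in> carrier R \<Longrightarrow> x \<preceq> x"
  using le_reflp by (simp add: reflp_on_def)

lemma le_trans:
  "\<lbrakk>x \<preceq> y; y \<preceq> z; x \<in> carrier R; y \<in> carrier R; z \<in> carrier R\<rbrakk> \<Longrightarrow> x \<preceq> z"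
  using le_transp unfolding transp_on_def by blast

lemma le_total: "\<lbrakk>x \<in> carrier R; y \<in> carrier R\<rbrakk> \<Longrightarrow> x \<preceq> y \<or> y \<preceq> x"
  using totalp_onD[OF le_totalp, of x y] le_refl[of x] by (cases "x = y") auto

end

context quasi_ordered_cring
begin

text \<open>Apply (QR4) to the addition of \<open>\<ominus> z\<close>; the last hypothesis is its
  side condition there. Cancellation can fail without it.\<close>

lemma le_add_cancel:
  assumes "x \<in> carrier R" "y \<in> carrier R" "z \<in> carrier R"
    and "x \<oplus> z \<preceq> y \<oplus> z" "\<not> \<ominus> z \<sim> y \<oplus> z"
  shows "x \<preceq> y"
proof -
  have "x \<oplus> z \<oplus> \<ominus> z \<preceq> y \<oplus> z \<oplus> \<ominus> z"
    using assms by - (rule QR4, auto)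
  then show ?thesis
    using assms by (simp add: a_assoc r_neg)
qed

text \<open>Add \<open>y\<close> to \<open>x \<preceq> \<zero>\<close> and to
  \<open>\<zero> \<preceq> x\<close>. As \<open>y\<close> lies outside the class of
  \<open>\<zero>\<close>, which is also that of \<open>x\<close>, (QR4) permits both.\<close>

lemma add_support_equivalent_nonzero:
  assumes "x \<in> carrier R" "y \<in> carrier R" "x \<sim> \<zero>" "\<not> y \<sim> \<zero>"
  shows "x \<oplus> y \<sim> y"
proof
  show "x \<oplus> y \<preceq> y"
    using QR4[of x \<zero> y] assms by simp
  have "\<not> y \<sim> x"
    using assms le_trans[of y x \<zero>] le_trans[of \<zero> x y] by blast
  then show "y \<preceq> x \<oplus> y"
    using QR4[of \<zero> x y] assms by simp
qed

text \<open>If \<open>\<ominus> x\<close> were outside the support, adding \<open>x\<close> would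
  not change its class; but the sum is \<open>\<zero>\<close>.\<close>

lemma support_minus:
  assumes "x \<in> carrier R" "x \<sim> \<zero>"
  shows "\<ominus> x \<sim> \<zero>"
  using add_support_equivalent_nonzero[of x "\<ominus> x"] assms by (auto simp: r_neg)

text \<open>If the sum were outside the support, adding \<open>\<ominus> x\<close> would keep its
  class, yet it produces \<open>y\<close>, which is in the support.\<close>

lemma support_add:
  assumes "x \<in> carrier R" "y \<in> carrier R" "x \<sim> \<zero>" "y \<sim> \<zero>"
  shows "x \<oplus> y \<sim> \<zero>"
proof (rule ccontr)
  assume nz: "\<not> x \<oplus> y \<sim> \<zero>"
  have "\<ominus> x \<oplus> (x \<oplus> y) \<sim> x \<oplus> y"
    using assms nz by (intro add_support_equivalent_nonzero support_minus) auto
  then have "y \<sim> x \<oplus> y"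
    using assms by (simp add: a_assoc[symmetric] l_neg)
  then show False
    using nz assms le_trans[of "x \<oplus> y" y \<zero>] le_trans[of \<zero> y "x \<oplus> y"] by blast
qed

lemma add_support_equivalent:
  assumes "x \<in> carrier R" "y \<in> carrier R" "x \<sim> \<zero>"
  shows "x \<oplus> y \<sim> y"
proof (cases "y \<sim> \<zero>")
  case True
  then show ?thesis
    using support_add[of x y] assms le_trans[of "x \<oplus> y" \<zero> y] le_trans[of y \<zero> "x \<oplus> y"] by blast
next
  case False
  then show ?thesis
    using add_support_equivalent_nonzero assms by blast
qed

text \<open>This holds whatever the sign of \<open>\<ominus> \<one>\<close>: (QR4) adds
  \<open>\<ominus> x\<close> to \<open>x \<preceq> \<zero>\<close>, and the excluded case
  \<open>\<ominus> x \<sim> \<zero>\<close> is trivial. The dual \<open>minus_nonpos\<close> is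
  where the sign of \<open>\<ominus> \<one>\<close> enters.\<close>

lemma minus_nonneg:
  assumes "x \<in> carrier R" "x \<preceq> \<zero>"
  shows "\<zero> \<preceq> \<ominus> x"
  using QR4[of x \<zero> "\<ominus> x"] assms by (cases "\<ominus> x \<sim> \<zero>") (auto simp: r_neg)

lemma support_minus_iff:
  assumes "x \<in> carrier R"
  shows "\<ominus> x \<sim> \<zero> \<longleftrightarrow> x \<sim> \<zero>"
  using support_minus[of x] support_minus[of "\<ominus> x"] minus_minus[OF assms]
    a_inv_closed[OF assms] assms by metis

section \<open>The case of a nonpositive minus one\<close>

lemma minus_neg:
  assumes "\<ominus> \<one> \<preceq> \<zero>" "x \<in> carrier R" "\<zero> \<prec> x"
  shows "\<ominus> x \<prec> \<zero>"
proof -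
  have "\<ominus> \<one> \<otimes> x \<preceq> \<zero> \<otimes> x"
    using assms by - (rule QR3, auto)
  then have "\<ominus> x \<preceq> \<zero>"
    using assms by (simp add: l_minus)
  then show ?thesis
    using support_minus_iff[of x] assms by blast
qed

text \<open>From \<open>x \<oplus> y \<preceq> \<zero>\<close>, adding \<open>\<ominus> y\<close>,
  which is not equivalent to \<open>\<zero>\<close>, would give
  \<open>x \<preceq> \<ominus> y \<prec> \<zero>\<close>.\<close>

lemma add_pos:
  assumes "\<ominus> \<one> \<preceq> \<zero>" "x \<in> carrier R" "y \<in> carrier R" "\<zero> \<prec> x" "\<zero> \<prec> y"
  shows "\<zero> \<prec> x \<oplus> y"
proof -
  have "\<not> x \<oplus> y \<preceq> \<zero>"
  proof
    assume le: "x \<oplus> y \<preceq> \<zero>"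
    have neg: "\<ominus> y \<prec> \<zero>"
      using minus_neg[of y] assms by simp
    then have "x \<oplus> y \<oplus> \<ominus> y \<preceq> \<zero> \<oplus> \<ominus> y"
      using le assms by - (rule QR4, auto)
    then have "x \<preceq> \<ominus> y"
      using assms by (simp add: a_assoc r_neg)
    then show False
      using neg assms le_trans[of x "\<ominus> y" \<zero>] by auto
  qed
  then show ?thesis
    using le_total[of "x \<oplus> y" \<zero>] assms by auto
qed

lemma pos_not_le_minus:
  assumes "\<ominus> \<one> \<preceq> \<zero>" "x \<in> carrier R" "y \<in> carrier R" "\<zero> \<prec> x" "\<zero> \<prec> y"
  shows "\<not> x \<preceq> \<ominus> y"
  using minus_neg[of y] assms le_trans[of x "\<ominus> y" \<zero>] by auto

lemma add_pos_not_le: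
  assumes "\<ominus> \<one> \<preceq> \<zero>" "x \<in> carrier R" "y \<in> carrier R" "\<zero> \<prec> x" "\<zero> \<prec> y"
  shows "\<not> x \<oplus> y \<preceq> y"
  using le_add_cancel[of x \<zero> y] pos_not_le_minus[of y y] assms by auto

lemma add_mono_pos:
  assumes m: "\<ominus> \<one> \<preceq> \<zero>" and car: "x \<in> carrier R" "y \<in> carrier R" "z \<in> carrier R"
    and "x \<preceq> y" "\<zero> \<prec> y"
  shows "x \<oplus> z \<preceq> y \<oplus> z"
proof (cases "z \<sim> y")
  case False
  then show ?thesis
    using assms QR4 by blast
next
  case True
  then have z: "\<zero> \<prec> z"
    using assms le_trans[of \<zero> y z] le_trans[of y z \<zero>] by blast
  have zz: "\<zero> \<prec> z \<oplus> z"
    using add_pos[of z z] z m car by simp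
  \<comment> \<open>\<open>z \<oplus> z\<close> lies strictly above \<open>z\<close>, and
    \<open>z \<sim> y\<close>.\<close>
  have "\<not> z \<oplus> z \<sim> y"
    using add_pos_not_le[of z z] m car z True le_trans[of "z \<oplus> z" y z] by blast
  then have "x \<oplus> (z \<oplus> z) \<preceq> y \<oplus> (z \<oplus> z)"
    using assms by - (rule QR4, auto)
  then have "x \<oplus> z \<oplus> z \<preceq> y \<oplus> z \<oplus> z"
    using car by (simp add: a_assoc)
  \<comment> \<open>The left side is negative and the right side positive, so one \<open>z\<close>
    can be cancelled.\<close>
  moreover have "\<not> \<ominus> z \<sim> y \<oplus> z \<oplus> z"
    using pos_not_le_minus[of "y \<oplus> z \<oplus> z" z] add_pos[of y "z \<oplus> z"] zz z assms
    by (auto simp: a_assoc)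
  ultimately show ?thesis
    using car le_add_cancel[of "x \<oplus> z" "y \<oplus> z" z] by simp
qed

lemma minus_nonpos:
  assumes "\<ominus> \<one> \<preceq> \<zero>" "x \<in> carrier R" "\<zero> \<preceq> x"
  shows "\<ominus> x \<preceq> \<zero>"
  using minus_neg[of x] support_minus_iff[of x] assms by blast

text \<open>Add first \<open>\<ominus> y\<close>, then \<open>\<ominus> x\<close>. (QR4) excludes
  \<open>\<ominus> y \<sim> y\<close> in the first step and
  \<open>\<ominus> x \<sim> \<zero>\<close> in the second, so elements of the support are treated
  apart by comparing signs.\<close>

lemma minus_antimono:
  assumes m: "\<ominus> \<one> \<preceq> \<zero>" and car: "x \<in> carrier R" "y \<in> carrier R" and le: "x \<preceq> y"
  shows "\<ominus> y \<preceq> \<ominus> x"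
proof (cases "x \<sim> \<zero> \<or> y \<sim> \<zero>")
  case True
  then show ?thesis
  proof
    assume x: "x \<sim> \<zero>"
    then have "\<ominus> y \<preceq> \<zero>"
      using minus_nonpos[of y] m car le le_trans[of \<zero> x y] by simp
    then show ?thesis
      using support_minus[OF car(1) x] car le_trans[of "\<ominus> y" \<zero> "\<ominus> x"] by auto
  next
    assume y: "y \<sim> \<zero>"
    then have "\<zero> \<preceq> \<ominus> x"
      using minus_nonneg[of x] car le le_trans[of x y \<zero>] by simp
    then show ?thesis
      using support_minus[OF car(2) y] car le_trans[of "\<ominus> y" \<zero> "\<ominus> x"] by auto
  qed
next
  case False
  \<comment> \<open>Outside the support, \<open>y\<close> and \<open>\<ominus> y\<close> have
    opposite signs.\<close>
  have "\<not> \<ominus> y \<sim> y"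
  proof (cases "\<zero> \<preceq> y")
    case True
    then show ?thesis
      using pos_not_le_minus[of y y] m car False by blast
  next
    case neg: False
    then have "\<zero> \<preceq> \<ominus> y"
      using minus_nonneg[of y] le_total[of y \<zero>] car by blast
    then show ?thesis
      using neg car le_trans[of \<zero> "\<ominus> y" y] by auto
  qed
  then have "x \<oplus> \<ominus> y \<preceq> y \<oplus> \<ominus> y"
    using car le by - (rule QR4, auto)
  then have "x \<oplus> \<ominus> y \<oplus> \<ominus> x \<preceq> \<zero> \<oplus> \<ominus> x"
    using car False support_minus_iff[of x] by - (rule QR4, auto simp: r_neg)
  moreover have "x \<oplus> \<ominus> y \<oplus> \<ominus> x = \<ominus> y"
    using car by (simp add: a_ac r_neg2)
  ultimately show ?thesis
    using car by simp
qed

lemma add_mono: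
  assumes m: "\<ominus> \<one> \<preceq> \<zero>" and car: "x \<in> carrier R" "y \<in> carrier R" "z \<in> carrier R"
    and le: "x \<preceq> y"
  shows "x \<oplus> z \<preceq> y \<oplus> z"
proof (cases "z \<sim> y")
  case False
  then show ?thesis
    using car le QR4 by blast
next
  case zy: True
  consider "\<zero> \<prec> y" | "y \<sim> \<zero>" | "y \<prec> \<zero>"
    using le_total[of y \<zero>] car by blast
  then show ?thesis
  proof cases
    case 1
    then show ?thesis
      using add_mono_pos[OF m car le] by simp
  next
    \<comment> \<open>Here \<open>z\<close> is in the support as well, so adding it changes no
      equivalence class.\<close>
    case 2
    then have "z \<sim> \<zero>"
      using zy car le_trans[of z y \<zero>] le_trans[of \<zero> y z] by blast
    then have "z \<oplus> x \<sim> x" "z \<oplus> y \<sim> y"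
      using add_support_equivalent[of z x] add_support_equivalent[of z y] car by simp_all
    then show ?thesis
      using car le le_trans[of "x \<oplus> z" x y] le_trans[of "x \<oplus> z" y "y \<oplus> z"]
      by (auto simp: a_comm)
  next
    case 3
    then have "\<not> \<zero> \<preceq> x"
      using car le le_trans[of \<zero> x y] by blast
    then have "\<zero> \<prec> \<ominus> x"
      using minus_nonneg[of x] support_minus_iff[of x] le_total[of x \<zero>] car by blast
    \<comment> \<open>After negation the larger side is the positive \<open>\<ominus> x\<close>;
      negating once more returns to the original elements.\<close>
    then have "\<ominus> y \<oplus> \<ominus> z \<preceq> \<ominus> x \<oplus> \<ominus> z"
      using minus_antimono[OF m _ _ le] m car by - (rule add_mono_pos, auto)
    then have "\<ominus> (y \<oplus> z) \<preceq> \<ominus> (x \<oplus> z)"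
      using car by (simp add: minus_add)
    then show ?thesis
      using minus_antimono[OF m, of "\<ominus> (y \<oplus> z)" "\<ominus> (x \<oplus> z)"] car by simp
  qed
qed

lemma ordered_cringI:
  assumes "\<ominus> \<one> \<preceq> \<zero>"
  shows "ordered_cring R (\<preceq>)"
  by unfold_locales (fact QR1 QR2 QR3 add_mono[OF assms])+

end

section \<open>The case of a nonnegative minus one\<close>

locale nonneg_quasi_ordered_cring = quasi_ordered_cring +
  assumes nonneg_minus_one: "\<zero> \<preceq> \<ominus> \<one>"
begin

text \<open>Totality gives one comparison of \<open>\<one>\<close> and
  \<open>\<ominus> \<one>\<close>; multiplying it by the nonnegative \<open>\<ominus> \<one>\<close>
  gives the other.\<close>

lemma minus_one_equivalent: "\<ominus> \<one> \<sim> \<one>"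
  using QR3[of "\<ominus> \<one>" \<one> "\<ominus> \<one>"] QR3[of \<one> "\<ominus> \<one>" "\<ominus> \<one>"] le_total[of \<one> "\<ominus> \<one>"]
    nonneg_minus_one by (auto simp: l_minus)

lemma minus_equivalent_of_nonneg:
  assumes "x \<in> carrier R" "\<zero> \<preceq> x"
  shows "\<ominus> x \<sim> x"
  using QR3[of "\<ominus> \<one>" \<one> x] QR3[of \<one> "\<ominus> \<one>" x] minus_one_equivalent assms
  by (auto simp: l_minus)

text \<open>If \<open>x \<preceq> \<zero>\<close>, then \<open>\<ominus> x\<close> is nonnegative,
  hence equivalent to its own negative, which is \<open>x\<close>.\<close>

lemma nonneg:
  assumes "x \<in> carrier R"
  shows "\<zero> \<preceq> x"
proof (cases "x \<preceq> \<zero>")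
  case True
  then have nn: "\<zero> \<preceq> \<ominus> x"
    using minus_nonneg assms by blast
  then have "\<ominus> x \<preceq> x"
    using minus_equivalent_of_nonneg[of "\<ominus> x"] assms by simp
  then show ?thesis
    using nn assms le_trans[of \<zero> "\<ominus> x" x] by auto
next
  case False
  then show ?thesis
    using le_total assms by blast
qed

lemma minus_equivalent: "x \<in> carrier R \<Longrightarrow> \<ominus> x \<sim> x"
  using minus_equivalent_of_nonneg nonneg by blast

lemma mult_mono:
  "\<lbrakk>x \<preceq> y; x \<in> carrier R; y \<in> carrier R; z \<in> carrier R\<rbrakk> \<Longrightarrow> x \<otimes> z \<preceq> y \<otimes> z"
  using QR3 nonneg by blast

text \<open>The ultrametric inequality. If the sum \<open>?w\<close> exceeded \<open>y\<close>,
  adding \<open>\<ominus> x\<close> to \<open>\<ominus> y \<preceq> ?w\<close> would give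
  \<open>\<ominus> ?w \<preceq> y\<close>, although \<open>\<ominus> ?w \<sim> ?w\<close>.\<close>

lemma add_le:
  assumes car: "x \<in> carrier R" "y \<in> carrier R" and le: "x \<preceq> y"
  shows "x \<oplus> y \<preceq> y"
proof (rule ccontr)
  assume nle: "\<not> x \<oplus> y \<preceq> y"
  let ?w = "x \<oplus> y"
  have w: "?w \<in> carrier R"
    using car by simp
  have yw: "\<ominus> y \<preceq> ?w"
    using le_total[of ?w y] nle minus_equivalent[of y] car w le_trans[of "\<ominus> y" y ?w] by auto
  \<comment> \<open>The side condition of (QR4): \<open>\<ominus> x\<close> is equivalent to
    \<open>x\<close>, and \<open>x \<preceq> y \<prec> ?w\<close>.\<close>
  have "\<not> \<ominus> x \<sim> ?w"
  proof
    assume "\<ominus> x \<sim> ?w"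
    then have "?w \<preceq> x"
      using minus_equivalent[of x] car w le_trans[of ?w "\<ominus> x" x] by auto
    then show False
      using nle le car w le_trans[of ?w x y] by auto
  qed
  then have "\<ominus> y \<oplus> \<ominus> x \<preceq> ?w \<oplus> \<ominus> x"
    using car yw by - (rule QR4, auto)
  moreover have "\<ominus> y \<oplus> \<ominus> x = \<ominus> ?w"
    using car by (simp add: minus_add a_comm)
  moreover have "?w \<oplus> \<ominus> x = y"
    using car by (simp add: a_comm[of x y] a_assoc r_neg)
  ultimately have "\<ominus> ?w \<preceq> y"
    by simp
  then show False
    using minus_equivalent[of ?w] nle car w le_trans[of ?w "\<ominus> ?w" y] by auto
qed

section \<open>The multiplicative set outside the support\<close>

definition nonsupport :: "'a set"
  where "nonsupport = {x \<in> carrier R. \<not> x \<preceq> \<zero>}"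

lemma nonsupport_closed [dest]: "x \<in> nonsupport \<Longrightarrow> x \<in> carrier R"
  by (simp add: nonsupport_def)

lemma nonsupport_pos: "x \<in> nonsupport \<Longrightarrow> \<zero> \<prec> x"
  using nonneg by (simp add: nonsupport_def)

lemma one_nonsupport [simp]: "\<one> \<in> nonsupport"
  using QR1 by (simp add: nonsupport_def)

lemma mult_nonsupport [simp]:
  "\<lbrakk>x \<in> nonsupport; y \<in> nonsupport\<rbrakk> \<Longrightarrow> x \<otimes> y \<in> nonsupport"
  using QR2 by (auto simp: nonsupport_def)

lemma mult_support:
  assumes "x \<in> carrier R" "y \<in> carrier R" "x \<preceq> \<zero>"
  shows "x \<otimes> y \<preceq> \<zero>"
  using mult_mono[of x \<zero> y] assms by simp

lemma mult_le_cancel: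
  "\<lbrakk>x \<otimes> z \<preceq> y \<otimes> z; x \<in> carrier R; y \<in> carrier R; z \<in> nonsupport\<rbrakk> \<Longrightarrow> x \<preceq> y"
  using QR5[of x y z] nonsupport_pos by blast

subsection \<open>The value group\<close>

text \<open>
  A pair \<open>(a, b)\<close> stands for the value \<open>v a - v b\<close>; larger elements have smaller values.
\<close>

abbreviation pairs :: "('a \<times> 'a) set"
  where "pairs \<equiv> nonsupport \<times> nonsupport"

text \<open>Cross-multiplied form of \<open>v a - v b \<le> v c - v d\<close>, that is, of
  \<open>v (a \<otimes> d) \<le> v (c \<otimes> b)\<close>; passing from values to elements reverses
  the order.\<close>

definition pair_le :: "'a \<times> 'a \<Rightarrow> 'a \<times> 'a \<Rightarrow> bool"
  where "pair_le p q \<longleftrightarrow> fst q \<otimes> snd p \<preceq> fst p \<otimes> snd q"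

definition pair_mult :: "'a \<times> 'a \<Rightarrow> 'a \<times> 'a \<Rightarrow> 'a \<times> 'a"
  where "pair_mult p q = (fst p \<otimes> fst q, snd p \<otimes> snd q)"

definition pair_class :: "'a \<times> 'a \<Rightarrow> ('a \<times> 'a) set"
  where "pair_class p = {q \<in> pairs. pair_le p q \<and> pair_le q p}"

text \<open>No representatives have to be chosen: \<open>class_le_iff\<close> shows that any two of
  them decide the comparison.\<close>

definition class_le :: "('a \<times> 'a) set \<Rightarrow> ('a \<times> 'a) set \<Rightarrow> bool"
  where "class_le A B \<longleftrightarrow> (\<exists>p \<in> A. \<exists>q \<in> B. pair_le p q)"

text \<open>The union in \<open>mult\<close> avoids choosing representatives: on classes of pairs
  all its members coincide, by \<open>value_group_mult\<close>.\<close>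

definition value_group :: "('a \<times> 'a) set monoid"
  where "value_group =
    \<lparr>carrier = pair_class ` pairs,
     mult = (\<lambda>A B. \<Union>p \<in> A. \<Union>q \<in> B. pair_class (pair_mult p q)),
     one = pair_class (\<one>, \<one>)\<rparr>"

definition quotient_value :: "'a \<Rightarrow> ('a \<times> 'a) set option"
  where "quotient_value x = (if x \<preceq> \<zero> then None else Some (pair_class (x, \<one>)))"

section \<open>The preorder on fractions and the group of its classes\<close>

lemma pair_le_refl: "p \<in> pairs \<Longrightarrow> pair_le p p"
  by (auto simp: pair_le_def le_refl nonsupport_closed)

text \<open>As for fractions: multiply each inequality by the missing factor, chain them, and cancel
  the middle denominator \<open>d\<close>, which (QR5) allows because \<open>d\<close> is outside
  the support.\<close>

lemma pair_le_trans:
  assumes "pair_le p q" "pair_le q r" "p \<in> pairs" "q \<in> pairs" "r \<in> pairs"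
  shows "pair_le p r"
proof -
  obtain a b c d e f where pqr: "p = (a, b)" "q = (c, d)" "r = (e, f)"
    by (cases p, cases q, cases r) auto
  have ns: "a \<in> nonsupport" "b \<in> nonsupport" "c \<in> nonsupport" "d \<in> nonsupport"
      "e \<in> nonsupport" "f \<in> nonsupport"
    using assms pqr by auto
  note car [simp] = ns[THEN nonsupport_closed]
  have "e \<otimes> d \<otimes> b \<preceq> c \<otimes> f \<otimes> b"
    using assms(2) pqr by - (rule mult_mono, auto simp: pair_le_def)
  moreover have "c \<otimes> b \<otimes> f \<preceq> a \<otimes> d \<otimes> f"
    using assms(1) pqr by - (rule mult_mono, auto simp: pair_le_def)
  moreover have "c \<otimes> f \<otimes> b = c \<otimes> b \<otimes> f" "e \<otimes> d \<otimes> b = e \<otimes> b \<otimes> d"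
      "a \<otimes> d \<otimes> f = a \<otimes> f \<otimes> d"
    by (simp_all add: m_ac)
  ultimately have "e \<otimes> b \<otimes> d \<preceq> a \<otimes> f \<otimes> d"
    using le_trans[of "e \<otimes> b \<otimes> d" "c \<otimes> b \<otimes> f" "a \<otimes> f \<otimes> d"] by simp
  then show ?thesis
    using mult_le_cancel[of "e \<otimes> b" d "a \<otimes> f"] ns pqr by (simp add: pair_le_def)
qed

lemma pair_le_total: "\<lbrakk>p \<in> pairs; q \<in> pairs\<rbrakk> \<Longrightarrow> pair_le p q \<or> pair_le q p"
  unfolding pair_le_def
  using le_total[of "fst q \<otimes> snd p" "fst p \<otimes> snd q"]
  by (auto simp: m_comm nonsupport_closed)

lemma pair_mult_pairs: "\<lbrakk>p \<in> pairs; q \<in> pairs\<rbrakk> \<Longrightarrow> pair_mult p q \<in> pairs"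
  by (auto simp: pair_mult_def)

lemma pair_mult_comm: "\<lbrakk>p \<in> pairs; q \<in> pairs\<rbrakk> \<Longrightarrow> pair_mult p q = pair_mult q p"
  by (auto simp: pair_mult_def m_comm nonsupport_closed)

lemma pair_mult_mono:
  assumes "pair_le p q" "p \<in> pairs" "q \<in> pairs" "r \<in> pairs"
  shows "pair_le (pair_mult p r) (pair_mult q r)"
proof -
  obtain a b c d e f where pqr: "p = (a, b)" "q = (c, d)" "r = (e, f)"
    by (cases p, cases q, cases r) auto
  have [simp]: "a \<in> carrier R" "b \<in> carrier R" "c \<in> carrier R" "d \<in> carrier R"
      "e \<in> carrier R" "f \<in> carrier R"
    using assms pqr by auto
  have "c \<otimes> b \<otimes> (e \<otimes> f) \<preceq> a \<otimes> d \<otimes> (e \<otimes> f)"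
    using assms(1) pqr by - (rule mult_mono, auto simp: pair_le_def)
  then show ?thesis
    using pqr by (simp add: pair_le_def pair_mult_def m_ac)
qed

lemma pair_mult_mono2:
  assumes "pair_le p p'" "pair_le q q'" "p \<in> pairs" "q \<in> pairs" "p' \<in> pairs" "q' \<in> pairs"
  shows "pair_le (pair_mult p q) (pair_mult p' q')"
proof -
  have "pair_le (pair_mult p q) (pair_mult p' q)"
    using assms pair_mult_mono by blast
  moreover have "pair_le (pair_mult p' q) (pair_mult p' q')"
    using pair_mult_mono[of q q' p'] assms by (simp add: pair_mult_comm)
  ultimately show ?thesis
    using assms by (blast intro: pair_le_trans pair_mult_pairs)
qed

lemma pair_class_self: "p \<in> pairs \<Longrightarrow> p \<in> pair_class p"
  by (simp add: pair_class_def pair_le_refl)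

lemma pair_class_eqI:
  assumes "p \<in> pairs" "q \<in> pairs" "pair_le p q" "pair_le q p"
  shows "pair_class p = pair_class q"
  unfolding pair_class_def using assms pair_le_trans by blast

lemma class_le_iff:
  assumes "p \<in> pairs" "q \<in> pairs"
  shows "class_le (pair_class p) (pair_class q) \<longleftrightarrow> pair_le p q"
proof
  assume "class_le (pair_class p) (pair_class q)"
  then obtain p' q' where "p' \<in> pairs" "pair_le p p'" "pair_le p' q'" "q' \<in> pairs" "pair_le q' q"
    by (auto simp: class_le_def pair_class_def)
  then show "pair_le p q"
    using assms pair_le_trans by meson
next
  assume "pair_le p q"
  then show "class_le (pair_class p) (pair_class q)"
    using assms pair_class_self class_le_def by blast
qed

lemma value_group_mult:
  assumes "p \<in> pairs" "q \<in> pairs"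
  shows "pair_class p \<otimes>\<^bsub>value_group\<^esub> pair_class q = pair_class (pair_mult p q)"
proof -
  have "pair_class (pair_mult p' q') = pair_class (pair_mult p q)"
    if "p' \<in> pair_class p" "q' \<in> pair_class q" for p' q'
    using that assms
    by (intro pair_class_eqI pair_mult_mono2 pair_mult_pairs) (simp_all add: pair_class_def)
  then have "(\<Union>p' \<in> pair_class p. \<Union>q' \<in> pair_class q. pair_class (pair_mult p' q'))
      = (\<Union>p' \<in> pair_class p. \<Union>q' \<in> pair_class q. pair_class (pair_mult p q))"
    by (intro SUP_cong refl)
  \<comment> \<open>The union is now of a constant family, and both index sets are nonempty because
    a class contains its representative.\<close>
  also have "\<dots> = pair_class (pair_mult p q)"
    using pair_class_self[OF assms(1)] pair_class_self[OF assms(2)] by auto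
  finally show ?thesis
    by (simp add: value_group_def)
qed

lemma value_group_carrier: "carrier value_group = pair_class ` pairs"
  by (simp add: value_group_def)

lemma value_group_one: "\<one>\<^bsub>value_group\<^esub> = pair_class (\<one>, \<one>)"
  by (simp add: value_group_def)

lemma pair_class_inverse:
  assumes "a \<in> nonsupport" "b \<in> nonsupport"
  shows "pair_class (b, a) \<otimes>\<^bsub>value_group\<^esub> pair_class (a, b) = \<one>\<^bsub>value_group\<^esub>"
proof -
  have "pair_class (pair_mult (b, a) (a, b)) = pair_class (\<one>, \<one>)"
    using assms
    by (intro pair_class_eqI)
      (auto simp: pair_mult_def pair_le_def m_comm nonsupport_closed le_refl)
  then show ?thesis
    using assms by (simp add: value_group_mult value_group_one)
qed

lemma comm_group_value_group: "comm_group value_group"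
proof (rule comm_groupI)
  fix A assume "A \<in> carrier value_group"
  then obtain a b where ab: "A = pair_class (a, b)" "a \<in> nonsupport" "b \<in> nonsupport"
    by (auto simp: value_group_carrier)
  then show "\<exists>B \<in> carrier value_group. B \<otimes>\<^bsub>value_group\<^esub> A = \<one>\<^bsub>value_group\<^esub>"
    using pair_class_inverse by (intro bexI[of _ "pair_class (b, a)"]) (auto simp: value_group_carrier)
qed (auto simp: value_group_carrier value_group_one value_group_mult pair_mult_def m_ac
    nonsupport_closed)

lemma totally_ordered_value_group: "totally_ordered_comm_group value_group class_le"
proof -
  interpret comm_group value_group
    by (rule comm_group_value_group)
  show ?thesis
  proof
    show "reflp_on (carrier value_group) class_le"
      using pair_le_refl class_le_iff by (auto simp: reflp_on_def value_group_carrier)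
    show "transp_on (carrier value_group) class_le"
      unfolding transp_on_def value_group_carrier ball_simps
      using pair_le_trans class_le_iff by blast
    show "antisymp_on (carrier value_group) class_le"
      unfolding antisymp_on_def value_group_carrier ball_simps
      using pair_class_eqI class_le_iff by blast
    show "totalp_on (carrier value_group) class_le"
      unfolding totalp_on_def value_group_carrier ball_simps
      using pair_le_total class_le_iff by blast
    fix A B C
    assume "A \<in> carrier value_group" "B \<in> carrier value_group" "C \<in> carrier value_group"
      and le: "class_le A B"
    then obtain p q r where "A = pair_class p" "B = pair_class q" "C = pair_class r"
        and "p \<in> pairs" "q \<in> pairs" "r \<in> pairs"
      unfolding value_group_carrier by blast
    then show "class_le (A \<otimes>\<^bsub>value_group\<^esub> C) (B \<otimes>\<^bsub>value_group\<^esub> C)"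
      using le pair_mult_mono by (simp add: value_group_mult class_le_iff pair_mult_pairs)
  qed
qed

section \<open>The quotient value as a valuation\<close>

lemma quotient_value_le_iff:
  assumes "x \<in> carrier R" "y \<in> carrier R"
  shows "value_le class_le (quotient_value y) (quotient_value x) \<longleftrightarrow> x \<preceq> y"
proof (cases "x \<preceq> \<zero>")
  \<comment> \<open>Elements of the support are the smallest, matching \<open>None\<close> as the
    largest value.\<close>
  case True
  then show ?thesis
    using assms le_trans[of x \<zero> y] nonneg[of y] by (simp add: quotient_value_def)
next
  case x: False
  show ?thesis
  proof (cases "y \<preceq> \<zero>")
    case True
    then show ?thesis
      using x assms le_trans[of x y \<zero>] by (auto simp: quotient_value_def)
  next
    case False
    then have "(x, \<one>) \<in> pairs" "(y, \<one>) \<in> pairs"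
      using x assms by (auto simp: nonsupport_def QR1)
    then show ?thesis
      using x False assms by (simp add: quotient_value_def class_le_iff pair_le_def)
  qed
qed

lemma quotient_value_mult:
  assumes "x \<in> carrier R" "y \<in> carrier R"
  shows "quotient_value (x \<otimes> y) = value_add value_group (quotient_value x) (quotient_value y)"
proof (cases "x \<preceq> \<zero> \<or> y \<preceq> \<zero>")
  case True
  then have "x \<otimes> y \<preceq> \<zero>"
    using mult_support[of x y] mult_support[of y x] assms by (auto simp: m_comm)
  then show ?thesis
    using True by (cases "quotient_value x") (auto simp: quotient_value_def)
next
  case False
  then have "x \<in> nonsupport" "y \<in> nonsupport"
    using assms by (auto simp: nonsupport_def)
  then show ?thesis
    using False QR2[of x y] assms
    by (auto simp: quotient_value_def value_group_mult pair_mult_def)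
qed

text \<open>The minimum of the two values belongs to the larger element, so this is
  \<open>add_le\<close> read through \<open>quotient_value_le_iff\<close>.\<close>

lemma quotient_value_add:
  assumes "x \<in> carrier R" "y \<in> carrier R"
  shows "value_le class_le (value_min class_le (quotient_value x) (quotient_value y))
    (quotient_value (x \<oplus> y))"
  using assms add_le[of x y] add_le[of y x] le_total[of x y]
  by (auto simp: value_min_def quotient_value_le_iff a_comm)

lemma quotient_value_generates:
  "generate value_group {g. \<exists>x \<in> carrier R. quotient_value x = Some g} = carrier value_group"
  (is "generate _ ?V = _")
proof -
  interpret comm_group value_group
    by (rule comm_group_value_group)
  have val: "pair_class (a, \<one>) \<in> ?V" if "a \<in> nonsupport" for a
    using that by (auto simp: quotient_value_def nonsupport_def)
  have sub: "?V \<subseteq> carrier value_group"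
    by (auto simp: quotient_value_def value_group_carrier nonsupport_def QR1 split: if_splits)
  have "pair_class (a, b) \<in> generate value_group ?V"
    if ab: "a \<in> nonsupport" "b \<in> nonsupport" for a b
  proof -
    have car: "pair_class (b, \<one>) \<in> carrier value_group" "pair_class (\<one>, b) \<in> carrier value_group"
      using ab by (auto simp: value_group_carrier)
    have inv: "inv\<^bsub>value_group\<^esub> (pair_class (b, \<one>)) = pair_class (\<one>, b)"
      using pair_class_inverse[of b \<one>] ab car by (intro inv_equality) auto
    \<comment> \<open>The fraction \<open>(a, b)\<close> is the value of \<open>a\<close> times the
      inverse of the value of \<open>b\<close>.\<close>
    have "pair_class (a, \<one>) \<otimes>\<^bsub>value_group\<^esub> inv\<^bsub>value_group\<^esub> (pair_class (b, \<one>))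
        \<in> generate value_group ?V"
      using val ab by (intro generate.eng generate.incl generate.inv)
    then show ?thesis
      unfolding inv using ab by (simp add: value_group_mult pair_mult_def nonsupport_closed)
  qed
  then show ?thesis
    using generate_incl[OF sub] by (auto simp: value_group_carrier)
qed

lemma ring_valuation_quotient_value: "ring_valuation R value_group class_le quotient_value"
proof -
  interpret G: totally_ordered_comm_group value_group class_le
    by (rule totally_ordered_value_group)
  show ?thesis
  proof
    show "quotient_value x \<in> insert None (Some ` carrier value_group)" if "x \<in> carrier R" for x
      using that by (auto simp: quotient_value_def value_group_carrier nonsupport_def QR1)
    show "quotient_value \<zero> = None" "quotient_value \<one> = Some \<one>\<^bsub>value_group\<^esub>"
      using le_refl QR1 by (simp_all add: quotient_value_def value_group_one)
  qed (fact quotient_value_mult quotient_value_add quotient_value_generates)+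
qed

lemma induced_by_quotient_value: "induced_by_valuation R (\<preceq>) class_le quotient_value"
  by (simp add: induced_by_valuation_def quotient_value_le_iff)

lemma support_quotient_value:
  "quasi_order_support R (\<preceq>) = valuation_support R quotient_value"
  using nonneg by (auto simp: quasi_order_support_def valuation_support_def quotient_value_def)

end

section \<open>The dichotomy\<close>

text \<open>Multiplying \<open>\<one> \<sqsubseteq> a\<close> by \<open>a\<close> gives
  \<open>a \<sqsubseteq> \<one>\<close>, and conversely; antisymmetry finishes.\<close>

lemma (in totally_ordered_comm_group) square_eq_one:
  assumes a: "a \<in> carrier G" and sq: "a \<otimes> a = \<one>"
  shows "a = \<one>"
proof -
  have "a \<sqsubseteq> \<one>" if "\<one> \<sqsubseteq> a"
    using group_le_mult[OF _ a a that] a sq by simp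
  moreover have "\<one> \<sqsubseteq> a" if "a \<sqsubseteq> \<one>"
    using group_le_mult[OF a _ a that] a sq by simp
  moreover have "a = \<one> \<or> a \<sqsubseteq> \<one> \<or> \<one> \<sqsubseteq> a"
    using group_le_totalp a unfolding totalp_on_def by blast
  ultimately show ?thesis
    using group_le_antisymp a unfolding antisymp_on_def by blast
qed

lemma (in ring_valuation) v_minus_one: "v (\<ominus> \<one>) = v \<one>"
proof -
  have sq: "value_add G (v (\<ominus> \<one>)) (v (\<ominus> \<one>)) = Some \<one>\<^bsub>G\<^esub>"
    using v_mult[of "\<ominus> \<one>" "\<ominus> \<one>"] v_one by (simp add: l_minus)
  then obtain g where g: "v (\<ominus> \<one>) = Some g"
    by (cases "v (\<ominus> \<one>)") auto
  then have "g \<in> carrier G"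
    using v_closed[of "\<ominus> \<one>"] by auto
  then show ?thesis
    using value_group.square_eq_one[of g] sq g v_one by simp
qed

text \<open>A valuation gives \<open>\<one>\<close> and \<open>\<ominus> \<one>\<close> the same
  value, so its order would have \<open>\<one> \<preceq> \<ominus> \<one>\<close>, whereas (O4) puts
  \<open>\<ominus> \<one>\<close> below \<open>\<zero>\<close>.\<close>

lemma (in ordered_cring) not_induced_by_valuation:
  assumes "ring_valuation R G leG v"
  shows "\<not> induced_by_valuation R (\<preceq>) leG v"
proof
  assume ind: "induced_by_valuation R (\<preceq>) leG v"
  interpret ring_valuation R G leG v
    by fact
  have "\<one> \<preceq> \<one>"
    using le_refl by simp
  then have "\<one> \<preceq> \<ominus> \<one>"
    using ind v_minus_one by (simp add: induced_by_valuation_def)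
  moreover have "\<ominus> \<one> \<preceq> \<zero>"
    using O4[of \<zero> \<one> "\<ominus> \<one>"] O1 by (simp add: r_neg)
  ultimately show False
    using O1 le_trans[of \<one> "\<ominus> \<one>" \<zero>] by simp
qed

theorem theorem4p6:
  fixes R :: "('a, 'm) ring_scheme"
    and leR :: "'a \<Rightarrow> 'a \<Rightarrow> bool"
  assumes "quasi_ordered_cring R leR"
  shows "((ordered_cring R leR \<and> quasi_order_support R leR = order_support R leR)
      \<or> (\<exists>(G :: ('a \<times> 'a) set monoid) leG v.
            ring_valuation R G leG v
            \<and> induced_by_valuation R leR leG v
            \<and> quasi_order_support R leR = valuation_support R v))
    \<and> \<not> (ordered_cring R leR
         \<and> (\<exists>(G :: 'g monoid) leG v.
               ring_valuation R G leG v \<and> induced_by_valuation R leR leG v))"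
proof
  interpret quasi_ordered_cring R leR
    by fact
  show "(ordered_cring R leR \<and> quasi_order_support R leR = order_support R leR)
      \<or> (\<exists>(G :: ('a \<times> 'a) set monoid) leG v.
            ring_valuation R G leG v
            \<and> induced_by_valuation R leR leG v
            \<and> quasi_order_support R leR = valuation_support R v)"
  proof (cases "leR (\<ominus>\<^bsub>R\<^esub> \<one>\<^bsub>R\<^esub>) \<zero>\<^bsub>R\<^esub>")
    case True
    then show ?thesis
      using ordered_cringI by (simp add: quasi_order_support_def order_support_def)
  next
    case False
    then have "leR \<zero>\<^bsub>R\<^esub> (\<ominus>\<^bsub>R\<^esub> \<one>\<^bsub>R\<^esub>)"
      using le_total[of "\<zero>\<^bsub>R\<^esub>" "\<ominus>\<^bsub>R\<^esub> \<one>\<^bsub>R\<^esub>"] by simp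
    then interpret nonneg_quasi_ordered_cring R leR
      by unfold_locales
    show ?thesis
      using ring_valuation_quotient_value induced_by_quotient_value support_quotient_value by blast
  qed
  \<comment> \<open>The alternatives exclude each other, for value groups over an arbitrary type
    \<open>'g\<close>.\<close>
  show "\<not> (ordered_cring R leR
         \<and> (\<exists>(G :: 'g monoid) leG v.
               ring_valuation R G leG v \<and> induced_by_valuation R leR leG v))"
    using ordered_cring.not_induced_by_valuation by blast
qed

end
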